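(* Let $V = V_O \sqcup V_P$ be a finite set of Boolean features partitioned into open features $V_O$ and private features $V_P$, let $s \in V_P$ be the sensitive feature with sensitive value $\nu$, let $X$ be the set of individuals over $V$, and let $\Delta : X \to D$ be a decision function. Let $x \in X$ be an individual with $x[s] = \nu$. Then there exists a Potentially Applicable Explanation (PAE) for $x$ that does not include the sensitive literal $s=\nu$ if and only if there is no leakage for $x$, i.e. if and only if $$\exists x' \in X.\quad x_O = x'_O \ \land\ x[s] \neq x'[s] \ \land\ \Delta(x) = \Delta(x').$$
   Context: Setting. $V = \{v_1,\dots,v_n\}$ is a finite set of Boolean variables (features), partitioned as $V = V_O \sqcup V_P$ into open and private features. An individual $x \in X = 2^V$ is an assignment of a Boolean value to every feature; it is also viewed as the set of its $n$ literals (for each $i$, either $v_i$ or $\neg v_i$). $x[v]$ denotes the value (equivalently, the literal) of $x$ on feature $v$. All assignments are allowed as individuals. $\Delta : X \to D$ is an arbitrary decision function into a set $D$. A feature $s \in V_P$ (the sensitive feature) and a Boolean value $\nu$ are fixed; the literal $s=\nu$ is called the sensitive literal. For a set $S$ of literals, $S_O$ denotes its restriction to the open features; $x_O$ is the open profile of $x$. Explanations. A set of literals $XP \subseteq x$ (for an individual $x$) is valid if for all $x' \in X$, $XP \subseteq x'$ implies $\Delta(x') = \Delta(x)$. An explanation of $x$'s decision (abductive explanation) is a valid $XP \subseteq x$ that is subset-minimal: no strict subset of $XP$ is valid. An explanation for $\Delta$ is a set of literals that is an explanation of the decision of some individual. PAE. A Potentially Applicable Explanation (PAE) for $x$ is an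 explanation $XP$ for $\Delta$ such that $XP_O \subseteq x_O$ and $XP$ leads to the same decision as $x$ (i.e. every individual $x' \supseteq XP$ has $\Delta(x') = \Delta(x)$). A PAE for $x$ need not be a subset of $x$. *)

theory Defs imports Main "HOL-Library.FuncSet" begin

text \<open>The pair \<open>(v, b)\<close> is the literal \<open>v = b\<close>: \<open>(v, True)\<close> is the positive
  literal of the feature \<open>v\<close> and \<open>(v, False)\<close> the negative one.\<close>

type_synonym 'v literal = "'v \<times> bool"

text \<open>Assignments are extensional functions, so two individuals are equal iff they agree
  on \<open>V\<close>.\<close>

definition individuals :: "'v set \<Rightarrow> ('v \<Rightarrow> bool) set" where
  "individuals V = (V \<rightarrow>\<^sub>E UNIV)"

definition literals :: "'v set \<Rightarrow> ('v \<Rightarrow> bool) \<Rightarrow> 'v literal set" where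
  "literals V x = (\<lambda>v. (v, x v)) ` V"

definition restrict_lits :: "'v set \<Rightarrow> 'v literal set \<Rightarrow> 'v literal set" where
  "restrict_lits W S = {l \<in> S. fst l \<in> W}"

definition leads_to :: "'v set \<Rightarrow> (('v \<Rightarrow> bool) \<Rightarrow> 'd) \<Rightarrow> 'v literal set \<Rightarrow> 'd \<Rightarrow> bool" where
  "leads_to V \<Delta> XP d \<longleftrightarrow>
     (\<forall>x'\<in>individuals V. XP \<subseteq> literals V x' \<longrightarrow> \<Delta> x' = d)"

definition valid ::
    "'v set \<Rightarrow> (('v \<Rightarrow> bool) \<Rightarrow> 'd) \<Rightarrow> ('v \<Rightarrow> bool) \<Rightarrow> 'v literal set \<Rightarrow> bool" where
  "valid V \<Delta> x XP \<longleftrightarrow> XP \<subseteq> literals V x \<and> leads_to V \<Delta> XP (\<Delta> x)"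

definition explanation_of ::
    "'v set \<Rightarrow> (('v \<Rightarrow> bool) \<Rightarrow> 'd) \<Rightarrow> ('v \<Rightarrow> bool) \<Rightarrow> 'v literal set \<Rightarrow> bool" where
  "explanation_of V \<Delta> x XP \<longleftrightarrow>
     valid V \<Delta> x XP \<and> \<not> (\<exists>XP'. XP' \<subset> XP \<and> valid V \<Delta> x XP')"

definition explanation ::
    "'v set \<Rightarrow> (('v \<Rightarrow> bool) \<Rightarrow> 'd) \<Rightarrow> 'v literal set \<Rightarrow> bool" where
  "explanation V \<Delta> XP \<longleftrightarrow> (\<exists>y\<in>individuals V. explanation_of V \<Delta> y XP)"

text \<open>The individual that \<open>XP\<close> explains need not be \<open>x\<close>; in particular \<open>XP\<close> may
  contain private literals that are false for \<open>x\<close>.\<close>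

definition PAE ::
    "'v set \<Rightarrow> 'v set \<Rightarrow> (('v \<Rightarrow> bool) \<Rightarrow> 'd) \<Rightarrow> ('v \<Rightarrow> bool) \<Rightarrow> 'v literal set \<Rightarrow> bool" where
  "PAE V V\<^sub>O \<Delta> x XP \<longleftrightarrow>
     explanation V \<Delta> XP \<and>
     restrict_lits V\<^sub>O XP \<subseteq> restrict_lits V\<^sub>O (literals V x) \<and>
     leads_to V \<Delta> XP (\<Delta> x)"

end

(* From a PAE XP for x avoiding s = nu, witnessed by an individual y with XP contained in y,
   one obtains x' by following x on the open features, flipping s, and following y elsewhere:
   x' contains XP, hence receives the decision of x. Conversely, any explanation of the
   decision of x' is a PAE for x. *)
theory Submission imports Defs begin

lemma mem_literals_iff: "(v, b) \<in> literals V x \<longleftrightarrow> v \<in> V \<and> x v = b"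
  by (auto simp: literals_def)

lemma restrict_lits_literals_eqI:
  assumes "\<And>v. v \<in> V \<Longrightarrow> v \<in> W \<Longrightarrow> x v = y v"
  shows "restrict_lits W (literals V x) = restrict_lits W (literals V y)"
  using assms by (auto simp: restrict_lits_def mem_literals_iff)

text \<open>Both literal sets assign exactly one value to every feature of \<open>V\<close>, so
  containment forces agreement on \<open>V\<close>, and extensionality does the rest. Hence only
  \<open>x\<close> itself extends its full literal set.\<close>

lemma literals_subset_literals_iff:
  assumes "x \<in> individuals V" "y \<in> individuals V"
  shows "literals V x \<subseteq> literals V y \<longleftrightarrow> x = y"
proof
  assume "literals V x \<subseteq> literals V y"
  then have "x v = y v" if "v \<in> V" for v
    using that by (auto simp: literals_def)
  then show "x = y"
    using assms unfolding individuals_def by (auto intro: PiE_ext)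
qed simp

lemma valid_literals:
  assumes "x \<in> individuals V"
  shows "valid V \<Delta> x (literals V x)"
  using assms by (auto simp: valid_def leads_to_def literals_subset_literals_iff)

text \<open>The valid sets for \<open>x\<close> form a finite family, being subsets of the finite
  set \<open>literals V x\<close>. It is nonempty because the full literal set is valid, so it has
  an inclusion-minimal member.\<close>

lemma ex_explanation_of:
  assumes "finite V" "x \<in> individuals V"
  obtains XP where "explanation_of V \<Delta> x XP"
proof -
  let ?A = "{XP. valid V \<Delta> x XP}"
  have "finite ?A"
    by (rule finite_subset[of _ "Pow (literals V x)"])
      (use \<open>finite V\<close> in \<open>simp_all add: literals_def valid_def Collect_mono Pow_def\<close>)
  moreover have "?A \<noteq> {}"
    using valid_literals[OF assms(2)] by blast
  ultimately obtain XP where "XP \<in> ?A" "\<And>Y. Y \<in> ?A \<Longrightarrow> Y \<subseteq> XP \<Longrightarrow> XP = Y"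
    using finite_has_minimal[of ?A] by auto
  then have "explanation_of V \<Delta> x XP"
    unfolding explanation_of_def by blast
  then show thesis by (rule that)
qed

theorem theorem1:
  fixes V V\<^sub>O V\<^sub>P :: "'v set" and s :: 'v and \<nu> :: bool
    and D :: "'d set" and \<Delta> :: "('v \<Rightarrow> bool) \<Rightarrow> 'd" and x :: "'v \<Rightarrow> bool"
  assumes "finite V"
    and "V = V\<^sub>O \<union> V\<^sub>P" and "V\<^sub>O \<inter> V\<^sub>P = {}"
    and "s \<in> V\<^sub>P"
    and "\<Delta> \<in> individuals V \<rightarrow> D"
    and "x \<in> individuals V" and "x s = \<nu>"
  shows "(\<exists>XP. PAE V V\<^sub>O \<Delta> x XP \<and> (s, \<nu>) \<notin> XP) \<longleftrightarrow>
    (\<exists>x'\<in>individuals V.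
       restrict_lits V\<^sub>O (literals V x) = restrict_lits V\<^sub>O (literals V x') \<and>
       x s \<noteq> x' s \<and> \<Delta> x = \<Delta> x')"
    (is "?lhs \<longleftrightarrow> ?rhs")
proof
  have s: "s \<in> V" "s \<notin> V\<^sub>O" and sub: "V\<^sub>O \<subseteq> V"
    using assms(2-4) by blast+
  assume ?lhs
  then obtain XP y where pae: "PAE V V\<^sub>O \<Delta> x XP" and sXP: "(s, \<nu>) \<notin> XP"
    and y: "y \<in> individuals V" "explanation_of V \<Delta> y XP"
    unfolding PAE_def explanation_def by blast
  have XPy: "XP \<subseteq> literals V y"
    using y(2) by (simp add: explanation_of_def valid_def)
  \<comment> \<open>As \<open>s\<close> is private, the first test does not catch it and its value
    is really flipped. Outside \<open>V\<close> the last branch applies, so \<open>x'\<close>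
    inherits the default value of \<open>y\<close> and stays extensional.\<close>
  define x' where "x' = (\<lambda>v. if v \<in> V\<^sub>O then x v else if v = s then \<not> \<nu> else y v)"
  have x': "x' \<in> individuals V"
    using y(1) s(1) sub by (auto simp: x'_def individuals_def PiE_def extensional_def)
  have "XP \<subseteq> literals V x'"
  proof
    fix l assume l: "l \<in> XP"
    obtain v b where vb: "l = (v, b)" by force
    have v: "v \<in> V" "y v = b"
      using l XPy by (auto simp: vb literals_def)
    \<comment> \<open>Although \<open>XP\<close> is taken from \<open>y\<close>, the PAE condition
      makes its open literals true for \<open>x\<close> as well.\<close>
    have "x v = b" if "v \<in> V\<^sub>O"
      using pae l that unfolding vb PAE_def restrict_lits_def
      by (auto simp: mem_literals_iff)
    \<comment> \<open>A literal of \<open>XP\<close> on \<open>s\<close> cannot be the sensitive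
      one, so it carries the only other Boolean value, which is the one \<open>x'\<close> takes at
      \<open>s\<close>.\<close>
    moreover have "b = (\<not> \<nu>)" if "v = s"
      using l sXP that vb by (cases b; cases \<nu>) auto
    ultimately show "l \<in> literals V x'"
      using v by (auto simp: vb mem_literals_iff x'_def)
  qed
  then have "\<Delta> x = \<Delta> x'"
    using pae x' by (simp add: PAE_def leads_to_def)
  moreover have "restrict_lits V\<^sub>O (literals V x) = restrict_lits V\<^sub>O (literals V x')"
    by (rule restrict_lits_literals_eqI) (simp add: x'_def)
  moreover have "x s \<noteq> x' s"
    using s assms(7) by (simp add: x'_def)
  ultimately show ?rhs
    using x' by blast
next
  assume ?rhs
  then obtain x' where x': "x' \<in> individuals V" "x s \<noteq> x' s" "\<Delta> x = \<Delta> x'"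
    and eq: "restrict_lits V\<^sub>O (literals V x) = restrict_lits V\<^sub>O (literals V x')"
    by blast
  obtain XP where XP: "explanation_of V \<Delta> x' XP"
    using ex_explanation_of[OF assms(1) x'(1)] .
  then have sub: "XP \<subseteq> literals V x'" and leads: "leads_to V \<Delta> XP (\<Delta> x')"
    by (auto simp: explanation_of_def valid_def)
  \<comment> \<open>Rewriting with \<open>eq\<close> replaces the open profile of \<open>x\<close>
    by that of \<open>x'\<close>, which contains the open part of \<open>XP\<close>. The individual
    explained is \<open>x'\<close>, whose decision equals that of \<open>x\<close>.\<close>
  have "PAE V V\<^sub>O \<Delta> x XP"
    unfolding PAE_def explanation_def eq
    using XP x' sub leads by (auto simp: restrict_lits_def)
  \<comment> \<open>All literals of \<open>XP\<close> hold in \<open>x'\<close>, and there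
    \<open>s\<close> does not have the value \<nu>.\<close>
  moreover have "(s, \<nu>) \<notin> XP"
    using sub x'(2) assms(7) by (auto simp: literals_def)
  ultimately show ?lhs by blast
qed

end
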